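(* Let $S$ be a densely defined, closed, symmetric operator in a Hilbert space $\mathcal H$ and let $\{\mathcal G,\Gamma_0,\Gamma_1\}$ be a quasi boundary triple for $T\subset S^*$ with corresponding $\gamma$-field $\gamma$ and Weyl function $M$; let $A_0=T\upharpoonright\ker\Gamma_0$ and $A_1=T\upharpoonright\ker\Gamma_1$. Let $B$ be a bounded self-adjoint operator in $\mathcal G$ and assume that there exists $\lambda_0\in\rho(A_0)\cap\mathbb R$ such that the following conditions are satisfied: (i) $1\in\rho\bigl(B\overline{M(\lambda_0)}\bigr)$; (ii) $B\bigl(\operatorname{ran}\overline{M(\lambda_0)}\bigr)\subset\operatorname{ran}\Gamma_0$; (iii) $B(\operatorname{ran}\Gamma_1)\subset\operatorname{ran}\Gamma_0$, or $\lambda_0\in\rho(A_1)$. Then the operator $$A_{[B]}f=Tf,\qquad \operatorname{dom}A_{[B]}=\bigl\{f\in\operatorname{dom}T:\Gamma_0 f=B\Gamma_1 f\bigr\},$$ is a self-adjoint extension of $S$ such that $\lambda_0\in\rho(A_{[B]})$, and $$(A_{[B]}-\lambda)^{-1}=(A_0-\lambda)^{-1}+\gamma(\lambda)\bigl(I-BM(\lambda)\bigr)^{-1}B\gamma(\overline\lambda)^*$$ holds for all $\lambda\in\rho(A_{[B]})\cap\rho(A_0)$.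
   Context: Let $S$ be a densely defined, closed, symmetric operator in $\mathcal H$, and let $T\subset S^*$ be a linear operator with $\overline T=S^*$. A triple $\{\mathcal G,\Gamma_0,\Gamma_1\}$ is a quasi boundary triple for $T\subset S^*$ if $\mathcal G$ is a Hilbert space and $\Gamma_0,\Gamma_1:\operatorname{dom}T\to\mathcal G$ are linear maps such that: (1) $(Tf,g)-(f,Tg)=(\Gamma_1f,\Gamma_0g)-(\Gamma_0f,\Gamma_1g)$ for all $f,g\in\operatorname{dom}T$; (2) $(\Gamma_0,\Gamma_1)^\top:\operatorname{dom}T\to\mathcal G\times\mathcal G$ has dense range; (3) $A_0:=T\upharpoonright\ker\Gamma_0$ is self-adjoint in $\mathcal H$. Put $A_1:=T\upharpoonright\ker\Gamma_1$ (not necessarily self-adjoint). For $\lambda\in\rho(A_0)$ one has $\operatorname{dom}T=\ker\Gamma_0\,\dot+\,\ker(T-\lambda)$, so $\Gamma_0\upharpoonright\ker(T-\lambda)$ is injective with range $\operatorname{ran}\Gamma_0$. The $\gamma$-field is $\gamma(\lambda):=(\Gamma_0\upharpoonright\ker(T-\lambda))^{-1}$ (mapping $\operatorname{ran}\Gamma_0\subset\mathcal G$ onto $\ker(T-\lambda)$), and the Weyl function is $M(\lambda):=\Gamma_1\gamma(\lambda)$, an operator in $\mathcal G$ with domain $\operatorname{ran}\Gamma_0$, $\lambda\in\rho(A_0)$. One has $M(\lambda)\subset M(\overline\lambda)^*$, so $M(\lambda)$ is closable; $\overline{M(\lambda)}$ denotes its closure. The adjoint $\gamma(\lambda)^*$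 is bounded and everywhere defined from $\mathcal H$ to $\mathcal G$. *)

theory Defs
  imports "HOL-Analysis.Analysis"
begin

section \<open>Complex Hilbert spaces\<close>

text \<open>The inner product is linear in the first argument. Not assumed: separability,
  or that the space is nonzero.\<close>

class complex_hilbert = banach +
  fixes scaleC :: "complex \<Rightarrow> 'a \<Rightarrow> 'a"  (infixr \<open>*\<^sub>C\<close> 75)
    and cinner :: "'a \<Rightarrow> 'a \<Rightarrow> complex"
  assumes scaleC_add_right: "a *\<^sub>C (x + y) = a *\<^sub>C x + a *\<^sub>C y"
    and scaleC_add_left: "(a + b) *\<^sub>C x = a *\<^sub>C x + b *\<^sub>C x"
    and scaleC_scaleC: "a *\<^sub>C b *\<^sub>C x = (a * b) *\<^sub>C x"
    and scaleR_scaleC: "r *\<^sub>R x = complex_of_real r *\<^sub>C x"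
    and cinner_commute: "cinner x y = cnj (cinner y x)"
    and cinner_add_left: "cinner (x + y) z = cinner x z + cinner y z"
    and cinner_scaleC_left: "cinner (a *\<^sub>C x) y = a * cinner x y"
    and cinner_self: "cinner x x = complex_of_real ((norm x)\<^sup>2)"

lemma scaleC_one: "1 *\<^sub>C x = (x :: 'a :: complex_hilbert)"
  using scaleR_scaleC[of 1 x] by simp

global_interpretation complex_vector:
  vector_space "scaleC :: complex \<Rightarrow> 'a \<Rightarrow> 'a :: complex_hilbert"
  by unfold_locales
    (simp_all add: scaleC_add_right scaleC_add_left scaleC_scaleC scaleC_one)

instantiation prod :: (complex_hilbert, complex_hilbert) complex_hilbert
begin

definition scaleC_prod :: "complex \<Rightarrow> 'a \<times> 'b \<Rightarrow> 'a \<times> 'b"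
  where "scaleC_prod a p = (a *\<^sub>C fst p, a *\<^sub>C snd p)"

definition cinner_prod :: "'a \<times> 'b \<Rightarrow> 'a \<times> 'b \<Rightarrow> complex"
  where "cinner_prod p q = cinner (fst p) (fst q) + cinner (snd p) (snd q)"

instance
proof
  fix x y z :: "'a \<times> 'b" and a b :: complex and r :: real
  show "a *\<^sub>C (x + y) = a *\<^sub>C x + a *\<^sub>C y"
    by (simp add: scaleC_prod_def scaleC_add_right)
  show "(a + b) *\<^sub>C x = a *\<^sub>C x + b *\<^sub>C x"
    by (simp add: scaleC_prod_def scaleC_add_left)
  show "a *\<^sub>C b *\<^sub>C x = (a * b) *\<^sub>C x"
    by (simp add: scaleC_prod_def scaleC_scaleC)
  show "r *\<^sub>R x = complex_of_real r *\<^sub>C x"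
    by (simp add: scaleC_prod_def scaleR_prod_def scaleR_scaleC)
  show "cinner x y = cnj (cinner y x)"
    using cinner_commute[of "fst x" "fst y"] cinner_commute[of "snd x" "snd y"]
    by (simp add: cinner_prod_def)
  show "cinner (x + y) z = cinner x z + cinner y z"
    by (simp add: cinner_prod_def cinner_add_left)
  show "cinner (a *\<^sub>C x) y = a * cinner x y"
    by (simp add: cinner_prod_def scaleC_prod_def cinner_scaleC_left algebra_simps)
  show "cinner x x = complex_of_real ((norm x)\<^sup>2)"
    by (simp add: cinner_prod_def cinner_self norm_prod_def)
qed

end

section \<open>Unbounded linear operators\<close>

text \<open>An operator is identified with its graph. Thus \<open>Domain\<close>, \<open>Range\<close>, \<open>``\<close> and
  converse (\<open>A\<inverse>\<close>) are the domain, the range, the image of a set and the inverse;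
  \<open>\<subseteq>\<close> is extension of operators, \<open>closure\<close> is operator closure (in the product topology),
  and \<open>Id\<close> is the identity. Equality of graphs includes equality of the domains.\<close>

definition linear_operator :: "('a::complex_hilbert \<times> 'b::complex_hilbert) set \<Rightarrow> bool"
  where "linear_operator A \<longleftrightarrow> complex_vector.subspace A \<and> single_valued A"

definition app :: "('a \<times> 'b) set \<Rightarrow> 'a \<Rightarrow> 'b"  (infixr \<open>\<diamondop>\<close> 90)
  where "A \<diamondop> x = (THE y. (x, y) \<in> A)"

definition ker_op :: "('a \<times> 'b::zero) set \<Rightarrow> 'a set"
  where "ker_op A = {x. (x, 0) \<in> A}"

definition restrict_op :: "('a \<times> 'b) set \<Rightarrow> 'a set \<Rightarrow> ('a \<times> 'b) set"  (infixl \<open>\<restriction>\<close> 85)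
  where "A \<restriction> D = {(x, y). (x, y) \<in> A \<and> x \<in> D}"

definition op_plus :: "('a \<times> 'b::plus) set \<Rightarrow> ('a \<times> 'b) set \<Rightarrow> ('a \<times> 'b) set"
    (infixl \<open>+\<^sub>o\<close> 65)
  where "A +\<^sub>o B = {(x, y + z) |x y z. (x, y) \<in> A \<and> (x, z) \<in> B}"

definition op_minus :: "('a \<times> 'b::minus) set \<Rightarrow> ('a \<times> 'b) set \<Rightarrow> ('a \<times> 'b) set"
    (infixl \<open>-\<^sub>o\<close> 65)
  where "A -\<^sub>o B = {(x, y - z) |x y z. (x, y) \<in> A \<and> (x, z) \<in> B}"

text \<open>Operator product, i.e. \<^term>\<open>(O)\<close> with its arguments exchanged.\<close>

definition op_times :: "('b \<times> 'c) set \<Rightarrow> ('a \<times> 'b) set \<Rightarrow> ('a \<times> 'c) set"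
    (infixl \<open>\<cdot>\<^sub>o\<close> 70)
  where "A \<cdot>\<^sub>o B = B O A"

definition scalar_op :: "complex \<Rightarrow> ('a::complex_hilbert \<times> 'a) set"
  where "scalar_op c = {(x, c *\<^sub>C x) |x. True}"

definition densely_defined :: "('a::topological_space \<times> 'b) set \<Rightarrow> bool"
  where "densely_defined A \<longleftrightarrow> closure (Domain A) = UNIV"

text \<open>For linear \<^term>\<open>A\<close>, this graph is single-valued exactly when \<^term>\<open>A\<close> is
  densely defined.\<close>

definition op_adjoint ::
    "('a::complex_hilbert \<times> 'b::complex_hilbert) set \<Rightarrow> ('b \<times> 'a) set"
  where "op_adjoint A = {(y, z). \<forall>(u, v) \<in> A. cinner v y = cinner u z}"

definition symmetric_op :: "('a::complex_hilbert \<times> 'a) set \<Rightarrow> bool"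
  where "symmetric_op A \<longleftrightarrow> (\<forall>(f, f') \<in> A. \<forall>(g, g') \<in> A. cinner f' g = cinner f g')"

definition self_adjoint_op :: "('a::complex_hilbert \<times> 'a) set \<Rightarrow> bool"
  where "self_adjoint_op A \<longleftrightarrow> linear_operator A \<and> densely_defined A \<and> op_adjoint A = A"

definition bounded_everywhere_op ::
    "('a::complex_hilbert \<times> 'b::complex_hilbert) set \<Rightarrow> bool"
  where "bounded_everywhere_op A \<longleftrightarrow>
    linear_operator A \<and> Domain A = UNIV \<and> (\<exists>K. \<forall>(x, y) \<in> A. norm y \<le> K * norm x)"

text \<open>The operator is not required to be closed, but it is closed
  whenever its resolvent set is nonempty.\<close>

definition resolvent_set :: "('a::complex_hilbert \<times> 'a) set \<Rightarrow> complex set"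
  where "resolvent_set A = {c. bounded_everywhere_op ((A -\<^sub>o scalar_op c)\<inverse>)}"

section \<open>Quasi boundary triples\<close>

text \<open>The boundary space is the type \<^typ>\<open>'g\<close>; the operator \<^term>\<open>S\<close> is meant to be
  densely defined, closed and symmetric.\<close>

definition quasi_boundary_triple ::
    "('h::complex_hilbert \<times> 'h) set \<Rightarrow> ('h \<times> 'h) set \<Rightarrow>
     ('h \<times> 'g::complex_hilbert) set \<Rightarrow> ('h \<times> 'g) set \<Rightarrow> bool"
  where "quasi_boundary_triple S T \<Gamma>\<^sub>0 \<Gamma>\<^sub>1 \<longleftrightarrow>
    linear_operator T \<and> T \<subseteq> op_adjoint S \<and> closure T = op_adjoint S \<and>
    linear_operator \<Gamma>\<^sub>0 \<and> Domain \<Gamma>\<^sub>0 = Domain T \<and>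
    linear_operator \<Gamma>\<^sub>1 \<and> Domain \<Gamma>\<^sub>1 = Domain T \<and>
    (\<forall>f \<in> Domain T. \<forall>g \<in> Domain T.
       cinner (T \<diamondop> f) g - cinner f (T \<diamondop> g) =
       cinner (\<Gamma>\<^sub>1 \<diamondop> f) (\<Gamma>\<^sub>0 \<diamondop> g) - cinner (\<Gamma>\<^sub>0 \<diamondop> f) (\<Gamma>\<^sub>1 \<diamondop> g)) \<and>
    closure {(\<Gamma>\<^sub>0 \<diamondop> f, \<Gamma>\<^sub>1 \<diamondop> f) |f. f \<in> Domain T} = UNIV \<and>
    self_adjoint_op (T \<restriction> ker_op \<Gamma>\<^sub>0)"

definition gamma_field ::
    "('h::complex_hilbert \<times> 'h) set \<Rightarrow> ('h \<times> 'g::complex_hilbert) set \<Rightarrow>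
     complex \<Rightarrow> ('g \<times> 'h) set"
  where "gamma_field T \<Gamma>\<^sub>0 c = (\<Gamma>\<^sub>0 \<restriction> ker_op (T -\<^sub>o scalar_op c))\<inverse>"

definition weyl_function ::
    "('h::complex_hilbert \<times> 'h) set \<Rightarrow> ('h \<times> 'g::complex_hilbert) set \<Rightarrow>
     ('h \<times> 'g) set \<Rightarrow> complex \<Rightarrow> ('g \<times> 'g) set"
  where "weyl_function T \<Gamma>\<^sub>0 \<Gamma>\<^sub>1 c = \<Gamma>\<^sub>1 \<cdot>\<^sub>o gamma_field T \<Gamma>\<^sub>0 c"

definition A_bracket ::
    "('h::complex_hilbert \<times> 'h) set \<Rightarrow> ('h \<times> 'g::complex_hilbert) set \<Rightarrow>
     ('h \<times> 'g) set \<Rightarrow> ('g \<times> 'g) set \<Rightarrow> ('h \<times> 'h) set"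
  where "A_bracket T \<Gamma>\<^sub>0 \<Gamma>\<^sub>1 B =
    T \<restriction> {f \<in> Domain T. \<Gamma>\<^sub>0 \<diamondop> f = B \<diamondop> (\<Gamma>\<^sub>1 \<diamondop> f)}"

end

theory Submission imports Defs begin

text \<open>Throughout, \<open>A\<^sub>0\<close> and \<open>A\<^sub>1\<close> are the restrictions of \<open>T\<close> to the kernels of the two boundary maps,
  \<open>A\<^sub>B\<close> is the restriction to the boundary condition \<open>\<Gamma>\<^sub>0 f = B \<Gamma>\<^sub>1 f\<close>, and \<open>c\<^sup>*\<close> is the complex conjugate of \<open>c\<close>.

  Green's identity makes \<open>A\<^sub>B\<close> symmetric, because \<open>B\<close> is symmetric. Hence everything about \<open>A\<^sub>B\<close> follows once
  \<open>A\<^sub>B - \<mu>\<^sub>0\<close> is known to be onto for the real number \<open>\<mu>\<^sub>0\<close>: a densely defined symmetric operator with this property is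
  self-adjoint (\<open>self_adjoint_opI\<close>), and the inverse of \<open>A\<^sub>B - \<mu>\<^sub>0\<close> is an everywhere defined symmetric operator, which is
  bounded by the Hellinger--Toeplitz theorem (\<open>symmetric_surj_imp_resolvent_set\<close>). The domain is dense because
  \<open>A\<^sub>B\<close> extends \<open>S\<close>: both boundary maps vanish on the domain of \<open>S\<close>
  (\<open>minimal_operator_boundary_values\<close>).

  Surjectivity (\<open>A_bracket_surj\<close>) is a computation in the boundary space. With \<open>f\<^sub>0 = (A\<^sub>0 - \<mu>\<^sub>0)\<^sup>-\<^sup>1 h\<close> and
  \<open>f = f\<^sub>0 + \<gamma>(\<mu>\<^sub>0) x\<close>, the equation \<open>(A\<^sub>B - \<mu>\<^sub>0) f = h\<close> says that \<open>x - B M(\<mu>\<^sub>0) x = B \<Gamma>\<^sub>1 f\<^sub>0\<close>. The spectral hypothesis solves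
  this for the closure of \<open>M(\<mu>\<^sub>0)\<close>, and the two range conditions place the solution in \<open>ran \<Gamma>\<^sub>0\<close>, the domain of \<open>M(\<mu>\<^sub>0)\<close>
  itself. The alternative \<open>\<mu>\<^sub>0 \<in> \<rho>(A\<^sub>1)\<close> in the last hypothesis reduces to the other one, since then
  \<open>ran \<Gamma>\<^sub>1 = ran M(\<mu>\<^sub>0)\<close>.

  The same ansatz at an arbitrary \<open>c \<in> \<rho>(A\<^sub>0)\<close> gives the resolvent formula (\<open>krein_resolvent_formula\<close>) as an
  identity of graphs, once \<open>\<gamma>(c\<^sup>*)\<^sup>*\<close> is identified with \<open>\<Gamma>\<^sub>1 (A\<^sub>0 - c)\<^sup>-\<^sup>1\<close> (\<open>adjoint_gamma_field_iff\<close>). That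
  identification needs \<open>\<gamma>(c\<^sup>*)\<close> to be densely defined, hence \<open>A\<^sub>0 - c\<^sup>*\<close> to be onto, which for the
  self-adjoint \<open>A\<^sub>0\<close> is obtained from the Riesz representation theorem (\<open>self_adjoint_surj_cnj\<close>).\<close>

section \<open>The inner product, Riesz representation and bounded symmetric maps\<close>

lemma cinner_add_right:
  fixes x y z :: "'a::complex_hilbert"
  shows "cinner x (y + z) = cinner x y + cinner x z"
  by (metis cinner_add_left cinner_commute complex_cnj_add)

lemma cinner_scaleC_right:
  fixes x y :: "'a::complex_hilbert"
  shows "cinner x (a *\<^sub>C y) = cnj a * cinner x y"
  by (metis cinner_commute cinner_scaleC_left complex_cnj_mult)

lemma norm_scaleC: "norm (a *\<^sub>C x) = cmod a * norm (x :: 'a::complex_hilbert)"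
proof -
  have "complex_of_real ((norm (a *\<^sub>C x))\<^sup>2) = cinner (a *\<^sub>C x) (a *\<^sub>C x)"
    by (simp only: cinner_self)
  also have "\<dots> = (a * cnj a) * cinner x x"
    by (simp add: cinner_scaleC_left cinner_scaleC_right)
  also have "\<dots> = complex_of_real ((cmod a * norm x)\<^sup>2)"
    by (simp only: cinner_self power_mult_distrib of_real_mult complex_norm_square)
  finally have "complex_of_real ((norm (a *\<^sub>C x))\<^sup>2) = complex_of_real ((cmod a * norm x)\<^sup>2)" .
  then show ?thesis
    by (simp only: of_real_eq_iff) (simp add: power2_eq_iff_nonneg)
qed

lemma norm_add_square:
  fixes x y :: "'a::complex_hilbert"
  shows "(norm (x + y))\<^sup>2 = (norm x)\<^sup>2 + (norm y)\<^sup>2 + 2 * Re (cinner x y)"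
proof -
  have "complex_of_real ((norm (x + y))\<^sup>2)
      = cinner x x + cinner y y + (cinner x y + cnj (cinner x y))"
    unfolding cinner_self[symmetric]
    by (simp add: cinner_add_left cinner_add_right flip: cinner_commute)
  then have "Re (complex_of_real ((norm (x + y))\<^sup>2))
      = Re (cinner x x + cinner y y + (cinner x y + cnj (cinner x y)))"
    by (rule arg_cong)
  then show ?thesis by (simp add: cinner_self)
qed

text \<open>The Cauchy--Schwarz inequality: the real part is controlled by the triangle inequality,
  and multiplying \<open>x\<close> by a phase makes the inner product real.\<close>

lemma norm_cinner_le:
  fixes x y :: "'a::complex_hilbert"
  shows "cmod (cinner x y) \<le> norm x * norm y"
proof (cases "cinner x y = 0")
  case False
  define a where "a = cnj (cinner x y) / cmod (cinner x y)"
  have a: "cmod a = 1" using False by (simp add: a_def norm_divide)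
  have "a * cinner x y = complex_of_real (cmod (cinner x y))"
    using False complex_norm_square[of "cinner x y"]
    by (simp add: a_def power2_eq_square field_simps)
  then have re: "Re (cinner (a *\<^sub>C x) y) = cmod (cinner x y)"
    by (simp add: cinner_scaleC_left)
  have "(norm (a *\<^sub>C x + y))\<^sup>2 \<le> (norm (a *\<^sub>C x) + norm y)\<^sup>2"
    by (intro power_mono norm_triangle_ineq) simp
  then show ?thesis
    using re a by (simp add: norm_add_square norm_scaleC power2_sum)
qed simp

lemma bounded_bilinear_cinner: "bounded_bilinear (cinner :: 'a::complex_hilbert \<Rightarrow> _)"
proof
  show "\<exists>K. \<forall>(a::'a) b. norm (cinner a b) \<le> norm a * norm b * K"
    by (intro exI[of _ 1]) (simp add: norm_cinner_le)
qed (simp_all add: cinner_add_left cinner_add_right scaleR_scaleC cinner_scaleC_left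
    cinner_scaleC_right scaleR_conv_of_real)

global_interpretation cinner:
  bounded_bilinear "cinner :: 'a::complex_hilbert \<Rightarrow> 'a \<Rightarrow> complex"
  by (rule bounded_bilinear_cinner)

lemma cinner_eq_zero_iff: "cinner x x = 0 \<longleftrightarrow> x = (0 :: 'a::complex_hilbert)"
  by (simp add: cinner_self)

lemma cinner_ext:
  fixes y z :: "'a::complex_hilbert"
  assumes "\<And>x. cinner x y = cinner x z"
  shows "y = z"
  using assms[of "y - z"] cinner_eq_zero_iff[of "y - z"] by (simp add: cinner.diff_right)

lemma eq_on_closure_cinner:
  fixes D :: "'a::complex_hilbert set"
  assumes "closure D = UNIV" and "\<And>x. x \<in> D \<Longrightarrow> cinner x y = cinner x z"
  shows "y = z"
proof (rule cinner_ext)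
  fix x
  have "closed {x. cinner x y = cinner x z}"
    by (intro closed_Collect_eq continuous_intros cinner.continuous_on)
  then have "closure D \<subseteq> {x. cinner x y = cinner x z}"
    using assms(2) by (intro closure_minimal) auto
  then show "cinner x y = cinner x z" using assms(1) by auto
qed

lemma nonneg_quadratic_imp_linear_coeff_zero:
  fixes a b :: real
  assumes "\<And>t. 0 \<le> a * t\<^sup>2 + b * t" and "a \<ge> 0"
  shows "b = 0"
proof -
  \<comment> \<open>The quadratic is tested at \<open>- t\<close>; the \<open>+ 1\<close> makes the case \<open>a = 0\<close> harmless.\<close>
  define t where "t = b / (a + 1)"
  have b: "b = (a + 1) * t" using assms(2) by (simp add: t_def)
  have "0 \<le> a * (- t)\<^sup>2 + b * (- t)" by (rule assms(1))
  also have "\<dots> = - (t\<^sup>2)" by (simp add: b power2_eq_square algebra_simps)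
  finally show ?thesis by (simp add: b)
qed

text \<open>The representing vector minimizes \<open>\<parallel>x\<parallel>\<^sup>2 - 2 Re \<phi>(x)\<close>. By the parallelogram law a
  minimizing sequence is Cauchy, and the first variation at the minimum is the asserted
  identity.\<close>

lemma riesz_representation:
  fixes \<phi> :: "'a::complex_hilbert \<Rightarrow> complex"
  assumes add: "\<And>x y. \<phi> (x + y) = \<phi> x + \<phi> y"
    and scale: "\<And>c x. \<phi> (c *\<^sub>C x) = c * \<phi> x"
    and bound: "\<And>x. cmod (\<phi> x) \<le> K * norm x"
  obtains f where "\<And>x. \<phi> x = cinner x f"
proof -
  have scaleR: "\<phi> (r *\<^sub>R x) = of_real r * \<phi> x" for r x
    by (simp add: scaleR_scaleC scale)
  have lin: "bounded_linear \<phi>"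
    using bound by (intro bounded_linear_intro[where K = K])
      (auto simp: add scaleR scaleR_conv_of_real mult.commute)
  define J where "J x = (norm x)\<^sup>2 - 2 * Re (\<phi> x)" for x
  have J_lower: "- K\<^sup>2 \<le> J x" for x
  proof -
    have "Re (\<phi> x) \<le> K * norm x"
      using complex_Re_le_cmod[of "\<phi> x"] bound[of x] by linarith
    moreover have "0 \<le> (norm x - K)\<^sup>2" by simp
    ultimately show ?thesis by (simp add: J_def power2_diff algebra_simps)
  qed
  define m where "m = Inf (range J)"
  have bdd: "bdd_below (range J)" using J_lower by (intro bdd_belowI[of _ "- K\<^sup>2"]) auto
  have m_le: "m \<le> J x" for x
    unfolding m_def using bdd by (intro cInf_lower) auto
  have J_line: "J (x + y) = J x + (norm y)\<^sup>2 + 2 * Re (cinner x y) - 2 * Re (\<phi> y)" for x y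
    by (simp add: J_def norm_add_square add)
  have parallelogram: "(norm (x - y))\<^sup>2 \<le> 2 * (J x - m) + 2 * (J y - m)" for x y
  proof -
    have "J x + J y - 2 * J ((1/2) *\<^sub>R (x + y)) = (norm (x - y))\<^sup>2 / 2"
      using norm_add_square[of x y] norm_add_square[of x "- y"]
      by (simp add: J_def scaleR add power_mult_distrib power2_eq_square cinner.minus_right
          del: scaleR_add_right scaleR_half_double) (simp add: field_simps)
    moreover have "m \<le> J ((1/2) *\<^sub>R (x + y))" by (rule m_le)
    ultimately show ?thesis by argo
  qed
  have "\<exists>x. J x < m + 1 / real (Suc n)" for n
    using cInf_lessD[of "range J" "m + 1 / real (Suc n)"] by (force simp: m_def)
  then obtain X where X: "\<And>n. J (X n) < m + 1 / real (Suc n)" by metis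
  have "Cauchy X"
  proof (rule metric_CauchyI)
    fix e :: real assume e: "e > 0"
    obtain N where N: "1 / real (Suc N) < e\<^sup>2 / 4"
      using reals_Archimedean[of "e\<^sup>2 / 4"] e by (auto simp: inverse_eq_divide)
    show "\<exists>N. \<forall>p\<ge>N. \<forall>q\<ge>N. dist (X p) (X q) < e"
    proof (intro exI allI impI)
      fix p q assume pq: "p \<ge> N" "q \<ge> N"
      have "1 / real (Suc p) \<le> 1 / real (Suc N)" "1 / real (Suc q) \<le> 1 / real (Suc N)"
        using pq by (simp_all add: field_simps)
      then have "(norm (X p - X q))\<^sup>2 < e\<^sup>2"
        using parallelogram[of "X p" "X q"] X[of p] X[of q] N by argo
      then show "dist (X p) (X q) < e"
        using e by (simp add: dist_norm power_less_imp_less_base)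
    qed
  qed
  then obtain f where f: "X \<longlonglongrightarrow> f" by (auto simp: Cauchy_convergent_iff convergent_def)
  have "(\<lambda>n. J (X n)) \<longlonglongrightarrow> J f"
    unfolding J_def by (intro tendsto_intros f bounded_linear.tendsto[OF lin])
  moreover have "(\<lambda>n. m + 1 / real (Suc n)) \<longlonglongrightarrow> m + 0"
    by (intro tendsto_intros LIMSEQ_Suc[OF lim_1_over_n])
  ultimately have "J f \<le> m + 0"
    using X by (intro LIMSEQ_le[of "\<lambda>n. J (X n)"]) (auto intro: less_imp_le)
  then have Jf: "J f \<le> J x" for x using m_le[of x] by simp
  have re: "Re (cinner x f) = Re (\<phi> x)" for x
  proof -
    have "0 \<le> (norm x)\<^sup>2 * t\<^sup>2 + (2 * Re (cinner f x) - 2 * Re (\<phi> x)) * t" for t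
      using Jf[of "f + t *\<^sub>R x"] J_line[of f "t *\<^sub>R x"]
      by (simp add: scaleR cinner.scaleR_right power_mult_distrib algebra_simps)
    then have "2 * Re (cinner f x) - 2 * Re (\<phi> x) = 0"
      by (rule nonneg_quadratic_imp_linear_coeff_zero) simp
    then show ?thesis by (metis cinner_commute complex_cnj(1) cnj.sel(1) eq_iff_diff_eq_0
      mult_cancel_left right_diff_distrib zero_neq_numeral)
  qed
  have "\<phi> x = cinner x f" for x
  proof (rule complex_eqI)
    show "Re (\<phi> x) = Re (cinner x f)" by (simp add: re)
    show "Im (\<phi> x) = Im (cinner x f)"
      using re[of "\<i> *\<^sub>C x"] by (simp add: scale cinner_scaleC_left)
  qed
  then show thesis by (rule that)
qed

text \<open>The Hellinger--Toeplitz theorem. The vectors \<open>h\<close> for which \<open>u \<mapsto> (R u, h)\<close> is bounded with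
  constant \<open>n\<close> form closed sets, which exhaust the space as \<open>n\<close> grows because \<open>(R u, h) = (u, R h)\<close>.
  By Baire one of them contains a ball, and comparing its centre \<open>a\<close> with \<open>a + k\<close>, where \<open>k\<close> is a multiple of
  \<open>R u\<close>, bounds \<open>\<parallel>R u\<parallel>\<close>.\<close>

lemma hellinger_toeplitz:
  fixes R :: "'a::complex_hilbert \<Rightarrow> 'a"
  assumes sym: "\<And>x y. cinner (R x) y = cinner x (R y)"
  obtains K where "\<And>x. norm (R x) \<le> K * norm x"
proof -
  define F where "F n = {h. \<forall>u. cmod (cinner (R u) h) \<le> real n * norm u}" for n
  have cl: "closed (F n)" for n
    unfolding F_def by (intro closed_Collect_all closed_Collect_le continuous_intros
        cinner.continuous_on)
  have "h \<in> (\<Union>n. F n)" for h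
  proof -
    obtain n where n: "norm (R h) \<le> real n" using real_arch_simple by blast
    have "cmod (cinner (R u) h) \<le> real n * norm u" for u
    proof -
      have "cmod (cinner (R u) h) \<le> norm u * norm (R h)" by (simp add: sym norm_cinner_le)
      also have "\<dots> \<le> norm u * real n" by (intro mult_left_mono n) simp
      finally show ?thesis by (simp add: mult.commute)
    qed
    then show ?thesis by (auto simp: F_def)
  qed
  then have un: "(\<Union>n. F n) = UNIV" by blast
  have "\<exists>n. interior (F n) \<noteq> {}"
  proof (rule ccontr)
    assume "\<nexists>n. interior (F n) \<noteq> {}"
    then have "Met_TC.mtopology interior_of \<Union> (range F) = {}"
      using cl by (intro Met_TC.metric_Baire_category_alt)
        (auto simp: complete_UNIV mcomplete_iff_complete)
    then show False using un by simp
  qed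
  then obtain n a where "a \<in> interior (F n)" by blast
  then obtain r where r: "r > 0" "cball a r \<subseteq> F n" by (auto simp: mem_interior_cball)
  have "norm (R u) \<le> (2 * real n / r) * norm u" for u
  proof (cases "R u = 0")
    case False
    define k where "k = (r / norm (R u)) *\<^sub>R R u"
    have nk: "norm k = r" using False r by (simp add: k_def)
    have "a \<in> F n" "a + k \<in> F n" using r nk by (auto simp: dist_norm subset_iff)
    then have "cmod (cinner (R u) a) \<le> real n * norm u"
      "cmod (cinner (R u) (a + k)) \<le> real n * norm u" by (auto simp: F_def)
    moreover have "cinner (R u) (a + k) - cinner (R u) a = cinner (R u) k"
      by (simp add: cinner_add_right)
    moreover have "cinner (R u) k = complex_of_real (r * norm (R u))"
      using False by (simp add: k_def cinner.scaleR_right cinner_self scaleR_conv_of_real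
          power2_eq_square)
    ultimately have "r * norm (R u) \<le> real n * norm u + real n * norm u"
      using r norm_triangle_ineq4[of "cinner (R u) (a + k)" "cinner (R u) a"]
      by (simp add: norm_mult)
    then show ?thesis using r by (simp add: field_simps)
  qed (use r in auto)
  then show thesis by (rule that)
qed


section \<open>Graphs of operators, resolvents and symmetric operators\<close>

context
  fixes A :: "('a::complex_hilbert \<times> 'b::complex_hilbert) set"
  assumes lin: "linear_operator A"
begin

lemma linear_operator_zero: "(0, 0) \<in> A"
  using lin complex_vector.subspace_0[of A] by (simp add: linear_operator_def zero_prod_def)

lemma linear_operator_add: "(x, y) \<in> A \<Longrightarrow> (x', y') \<in> A \<Longrightarrow> (x + x', y + y') \<in> A"
  using lin complex_vector.subspace_add[of A "(x, y)" "(x', y')"]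
  by (simp add: linear_operator_def)

lemma linear_operator_diff: "(x, y) \<in> A \<Longrightarrow> (x', y') \<in> A \<Longrightarrow> (x - x', y - y') \<in> A"
  using lin complex_vector.subspace_diff[of A "(x, y)" "(x', y')"]
  by (simp add: linear_operator_def)

lemma linear_operator_scaleC: "(x, y) \<in> A \<Longrightarrow> (c *\<^sub>C x, c *\<^sub>C y) \<in> A"
  using lin complex_vector.subspace_scale[of A "(x, y)" c]
  by (simp add: linear_operator_def scaleC_prod_def)

lemma linear_operator_unique: "(x, y) \<in> A \<Longrightarrow> (x, y') \<in> A \<Longrightarrow> y = y'"
  using lin by (auto simp: linear_operator_def single_valued_def)

lemma linear_operator_app_eq: "(x, y) \<in> A \<Longrightarrow> A \<diamondop> x = y"
  unfolding app_def using linear_operator_unique by blast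

end

lemma linear_operatorI:
  fixes A :: "('a::complex_hilbert \<times> 'b::complex_hilbert) set"
  assumes "(0, 0) \<in> A"
    and "\<And>x y x' y'. (x, y) \<in> A \<Longrightarrow> (x', y') \<in> A \<Longrightarrow> (x + x', y + y') \<in> A"
    and "\<And>c x y. (x, y) \<in> A \<Longrightarrow> (c *\<^sub>C x, c *\<^sub>C y) \<in> A"
    and "\<And>x y y'. (x, y) \<in> A \<Longrightarrow> (x, y') \<in> A \<Longrightarrow> y = y'"
  shows "linear_operator A"
  unfolding linear_operator_def
proof
  show "complex_vector.subspace A"
    using assms(1-3) by (auto simp: complex_vector.subspace_def zero_prod_def scaleC_prod_def)
  show "single_valued A" using assms(4) by (auto simp: single_valued_def)
qed

lemma minus_scalar_op_iff: "(x, y) \<in> A -\<^sub>o scalar_op c \<longleftrightarrow> (x, y + c *\<^sub>C x) \<in> A"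
  by (force simp: op_minus_def scalar_op_def)

lemma op_plus_iff: "(x, z) \<in> A +\<^sub>o B \<longleftrightarrow> (\<exists>u v. z = u + v \<and> (x, u) \<in> A \<and> (x, v) \<in> B)"
  by (auto simp: op_plus_def)

lemma op_times_iff: "(x, z) \<in> A \<cdot>\<^sub>o B \<longleftrightarrow> (\<exists>y. (x, y) \<in> B \<and> (y, z) \<in> A)"
  by (auto simp: op_times_def)

lemma Id_minus_iff: "(x, y) \<in> Id -\<^sub>o A \<longleftrightarrow> (\<exists>w. (x, w) \<in> A \<and> y = x - w)"
  by (auto simp: op_minus_def)

lemma resolvent_set_imp_surj:
  assumes "c \<in> resolvent_set A"
  shows "\<exists>f. (f, h + c *\<^sub>C f) \<in> A"
proof -
  have "h \<in> Domain ((A -\<^sub>o scalar_op c)\<inverse>)"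
    using assms by (simp add: resolvent_set_def bounded_everywhere_op_def)
  then show ?thesis by (auto simp: minus_scalar_op_iff)
qed

lemma resolvent_set_imp_inj:
  assumes "c \<in> resolvent_set A" and "(f, h + c *\<^sub>C f) \<in> A" and "(g, h + c *\<^sub>C g) \<in> A"
  shows "f = g"
proof -
  have "linear_operator ((A -\<^sub>o scalar_op c)\<inverse>)"
    using assms(1) by (simp add: resolvent_set_def bounded_everywhere_op_def)
  then show ?thesis
    by (rule linear_operator_unique[of _ h]) (simp_all add: minus_scalar_op_iff assms(2,3))
qed

lemma resolvent_set_imp_ker_trivial:
  assumes "linear_operator A" and "c \<in> resolvent_set A" and "(f, c *\<^sub>C f) \<in> A"
  shows "f = 0"
  using resolvent_set_imp_inj[OF assms(2), of f 0 0] assms(3) linear_operator_zero[OF assms(1)]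
  by simp

lemma cnj_eq_of_mem_Reals: "c \<in> \<real> \<Longrightarrow> cnj c = c"
  by (simp add: Reals_cnj_iff)

lemma symmetric_opD:
  "symmetric_op A \<Longrightarrow> (f, f') \<in> A \<Longrightarrow> (g, g') \<in> A \<Longrightarrow> cinner f' g = cinner f g'"
  by (auto simp: symmetric_op_def)

lemma op_adjointD: "(y, z) \<in> op_adjoint A \<Longrightarrow> (u, v) \<in> A \<Longrightarrow> cinner v y = cinner u z"
  by (auto simp: op_adjoint_def)

lemma closed_op_adjoint: "closed (op_adjoint A)"
proof -
  have "op_adjoint A = (\<Inter>(u, v) \<in> A. {p. cinner v (fst p) = cinner u (snd p)})"
    by (auto simp: op_adjoint_def)
  then show ?thesis
    by (auto intro!: closed_INT closed_Collect_eq continuous_intros cinner.continuous_on)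
qed

text \<open>The adjoint cannot be larger than \<open>A\<close>: an element \<open>y\<close> of the adjoint domain has the same image under
  \<open>A\<^sup>* - c\<close> as some \<open>f\<close> of the domain, and \<open>y - f\<close> is orthogonal to the range of \<open>A - c\<close>.\<close>

lemma self_adjoint_opI:
  assumes lin: "linear_operator A" and dense: "densely_defined A" and sym: "symmetric_op A"
    and real: "c \<in> \<real>" and surj: "\<And>h. \<exists>f. (f, h + c *\<^sub>C f) \<in> A"
  shows "self_adjoint_op A"
proof -
  have "A \<subseteq> op_adjoint A"
    using sym by (auto simp: op_adjoint_def symmetric_opD)
  moreover have "op_adjoint A \<subseteq> A"
  proof clarify
    fix y z assume yz: "(y, z) \<in> op_adjoint A"
    obtain f where f: "(f, z - c *\<^sub>C y + c *\<^sub>C f) \<in> A" using surj by blast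
    have "y = f"
    proof (rule cinner_ext)
      fix h
      obtain u where u: "(u, h + c *\<^sub>C u) \<in> A" using surj by blast
      have "cinner (h + c *\<^sub>C u) y = cinner u z" by (rule op_adjointD[OF yz u])
      moreover have "cinner (h + c *\<^sub>C u) f = cinner u (z - c *\<^sub>C y + c *\<^sub>C f)"
        by (rule symmetric_opD[OF sym u f])
      ultimately show "cinner h y = cinner h f"
        using cnj_eq_of_mem_Reals[OF real]
        by (simp add: cinner_add_left cinner_add_right cinner.diff_right cinner_scaleC_left
            cinner_scaleC_right algebra_simps) (metis add_right_cancel)
    qed
    then show "(y, z) \<in> A" using f by simp
  qed
  ultimately show ?thesis using lin dense by (simp add: self_adjoint_op_def)
qed

text \<open>Here the inverse of \<open>A - c\<close> is everywhere defined and symmetric, so its boundedness is the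
  Hellinger--Toeplitz theorem.\<close>

lemma symmetric_surj_imp_resolvent_set:
  assumes lin: "linear_operator A" and sym: "symmetric_op A"
    and real: "c \<in> \<real>" and surj: "\<And>h. \<exists>f. (f, h + c *\<^sub>C f) \<in> A"
  shows "c \<in> resolvent_set A"
proof -
  have shift_sym: "cinner h g = cinner f k"
    if "(f, h + c *\<^sub>C f) \<in> A" "(g, k + c *\<^sub>C g) \<in> A" for f g h k
    using symmetric_opD[OF sym that] cnj_eq_of_mem_Reals[OF real]
    by (simp add: cinner_add_left cinner_add_right cinner_scaleC_left cinner_scaleC_right)
  obtain R where R: "\<And>h. (R h, h + c *\<^sub>C R h) \<in> A" using surj by metis
  have R_unique: "f = R h" if f: "(f, h + c *\<^sub>C f) \<in> A" for f h
  proof (rule cinner_ext)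
    fix k
    show "cinner k f = cinner k (R h)"
      using shift_sym[OF R f] shift_sym[OF R R] by metis
  qed
  obtain K where K: "\<And>h. norm (R h) \<le> K * norm h"
    using hellinger_toeplitz[of R] shift_sym[OF R R] by metis
  have graph: "(A -\<^sub>o scalar_op c)\<inverse> = {(h, R h) |h. True}"
    using R R_unique by (auto simp: minus_scalar_op_iff)
  have "linear_operator {(h, R h) |h. True}"
  proof (rule linear_operatorI)
    have "(0, 0 + c *\<^sub>C 0) \<in> A" using linear_operator_zero[OF lin] by simp
    then show "(0, 0) \<in> {(h, R h) |h. True}" using R_unique by blast
  next
    fix x y x' y' assume "(x, y) \<in> {(h, R h) |h. True}" "(x', y') \<in> {(h, R h) |h. True}"
    then have "(y, x + c *\<^sub>C y) \<in> A" "(y', x' + c *\<^sub>C y') \<in> A" using R by auto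
    then have "(y + y', (x + x') + c *\<^sub>C (y + y')) \<in> A"
      using linear_operator_add[OF lin] by (fastforce simp: scaleC_add_right algebra_simps)
    then show "(x + x', y + y') \<in> {(h, R h) |h. True}" using R_unique by auto
  next
    fix a x y assume "(x, y) \<in> {(h, R h) |h. True}"
    then have "(y, x + c *\<^sub>C y) \<in> A" using R by auto
    then have "(a *\<^sub>C y, (a *\<^sub>C x) + c *\<^sub>C (a *\<^sub>C y)) \<in> A"
      using linear_operator_scaleC[OF lin, of y "x + c *\<^sub>C y" a]
      by (simp add: scaleC_add_right scaleC_scaleC mult.commute)
    then show "(a *\<^sub>C x, a *\<^sub>C y) \<in> {(h, R h) |h. True}" using R_unique by auto
  qed auto
  then show ?thesis
    unfolding resolvent_set_def bounded_everywhere_op_def mem_Collect_eq graph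
    using K by auto
qed

text \<open>The resolvent set of a self-adjoint operator is symmetric about the real axis, of which
  surjectivity is the part needed below. The candidate preimage of \<open>h\<close> represents the bounded functional
  \<open>k \<mapsto> ((A - c)\<^sup>-\<^sup>1 k, h)\<close>, i.e. it is the adjoint resolvent applied to \<open>h\<close>.\<close>

lemma self_adjoint_surj_cnj:
  assumes sa: "self_adjoint_op A" and c: "c \<in> resolvent_set A"
  shows "\<exists>f. (f, h + cnj c *\<^sub>C f) \<in> A"
proof -
  have lin: "linear_operator A" and adj: "op_adjoint A = A"
    using sa by (simp_all add: self_adjoint_op_def)
  obtain R where R: "\<And>k. (R k, k + c *\<^sub>C R k) \<in> A"
    using resolvent_set_imp_surj[OF c] by metis
  have R_unique: "f = R k" if "(f, k + c *\<^sub>C f) \<in> A" for f k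
    using resolvent_set_imp_inj[OF c that R] .
  obtain K where K: "\<And>x y. (x, y) \<in> (A -\<^sub>o scalar_op c)\<inverse> \<Longrightarrow> norm y \<le> K * norm x"
    using c by (fastforce simp: resolvent_set_def bounded_everywhere_op_def)
  obtain f where f: "\<And>k. cinner (R k) h = cinner k f"
  proof (rule riesz_representation[of "\<lambda>k. cinner (R k) h" "K * norm h"])
    fix x y a
    have "(R x + R y, (x + y) + c *\<^sub>C (R x + R y)) \<in> A"
      using linear_operator_add[OF lin R[of x] R[of y]]
      by (simp add: scaleC_add_right algebra_simps)
    then show "cinner (R (x + y)) h = cinner (R x) h + cinner (R y) h"
      using R_unique by (metis cinner_add_left)
    have "(a *\<^sub>C R x, a *\<^sub>C x + c *\<^sub>C a *\<^sub>C R x) \<in> A"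
      using linear_operator_scaleC[OF lin R[of x], of a]
      by (simp add: scaleC_add_right scaleC_scaleC mult.commute)
    then show "cinner (R (a *\<^sub>C x)) h = a * cinner (R x) h"
      using R_unique by (metis cinner_scaleC_left)
    have "cmod (cinner (R x) h) \<le> norm (R x) * norm h" by (rule norm_cinner_le)
    also have "\<dots> \<le> (K * norm x) * norm h"
      using K[of x "R x"] R by (intro mult_right_mono) (simp_all add: minus_scalar_op_iff)
    finally show "cmod (cinner (R x) h) \<le> K * norm h * norm x" by (simp add: mult_ac)
  qed (rule that)
  have "(f, h + cnj c *\<^sub>C f) \<in> op_adjoint A"
    unfolding op_adjoint_def
  proof clarify
    fix u v assume uv: "(u, v) \<in> A"
    have "(u, (v - c *\<^sub>C u) + c *\<^sub>C u) \<in> A" using uv by simp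
    then have "u = R (v - c *\<^sub>C u)" by (rule R_unique)
    then have "cinner u h = cinner (v - c *\<^sub>C u) f" using f by metis
    then show "cinner v f = cinner u (h + cnj c *\<^sub>C f)"
      by (simp add: cinner.diff_left cinner_add_right cinner_scaleC_left cinner_scaleC_right)
  qed
  then show ?thesis using adj by auto
qed

section \<open>The gamma-field and the Weyl function of a quasi boundary triple\<close>

lemma gamma_field_iff: "(x, f) \<in> gamma_field T G0 c \<longleftrightarrow> (f, x) \<in> G0 \<and> (f, c *\<^sub>C f) \<in> T"
  by (auto simp: gamma_field_def restrict_op_def ker_op_def minus_scalar_op_iff)

lemma weyl_function_iff:
  "(x, y) \<in> weyl_function T G0 G1 c \<longleftrightarrow> (\<exists>f. (f, x) \<in> G0 \<and> (f, c *\<^sub>C f) \<in> T \<and> (f, y) \<in> G1)"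
  by (auto simp: weyl_function_def op_times_def gamma_field_iff)

lemma restrict_ker_op_iff: "(f, f') \<in> T \<restriction> ker_op G \<longleftrightarrow> (f, f') \<in> T \<and> (f, 0) \<in> G"
  by (auto simp: restrict_op_def ker_op_def)

locale quasi_bt =
  fixes S T :: "('h::complex_hilbert \<times> 'h) set"
    and G0 G1 :: "('h \<times> 'g::complex_hilbert) set"
  assumes qbt: "quasi_boundary_triple S T G0 G1"
begin

lemma linear_T: "linear_operator T" and linear_G0: "linear_operator G0"
  and linear_G1: "linear_operator G1"
  using qbt by (simp_all add: quasi_boundary_triple_def)

lemma self_adjoint_A0: "self_adjoint_op (T \<restriction> ker_op G0)"
  using qbt by (simp add: quasi_boundary_triple_def)

lemma linear_A0: "linear_operator (T \<restriction> ker_op G0)"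
  using self_adjoint_A0 by (simp add: self_adjoint_op_def)

lemma boundary_values:
  assumes "(f, f') \<in> T"
  obtains x y where "(f, x) \<in> G0" and "(f, y) \<in> G1"
proof -
  have "f \<in> Domain G0" "f \<in> Domain G1"
    using assms qbt by (auto simp: quasi_boundary_triple_def)
  then show thesis using that by blast
qed

lemma G0_domain:
  assumes "(f, x) \<in> G0"
  obtains f' where "(f, f') \<in> T"
  using assms qbt that unfolding quasi_boundary_triple_def by blast

lemma G1_domain:
  assumes "(f, x) \<in> G1"
  obtains f' where "(f, f') \<in> T"
  using assms qbt that unfolding quasi_boundary_triple_def by blast

lemma green:
  assumes "(f, f') \<in> T" "(f, x0) \<in> G0" "(f, x1) \<in> G1"
    and "(g, g') \<in> T" "(g, y0) \<in> G0" "(g, y1) \<in> G1"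
  shows "cinner f' g - cinner f g' = cinner x1 y0 - cinner x0 y1"
proof -
  note app = linear_operator_app_eq[OF linear_T] linear_operator_app_eq[OF linear_G0]
    linear_operator_app_eq[OF linear_G1]
  have "f \<in> Domain T" "g \<in> Domain T" using assms by auto
  then have "cinner (T \<diamondop> f) g - cinner f (T \<diamondop> g)
      = cinner (G1 \<diamondop> f) (G0 \<diamondop> g) - cinner (G0 \<diamondop> f) (G1 \<diamondop> g)"
    using qbt by (simp add: quasi_boundary_triple_def)
  then show ?thesis using assms by (simp add: app)
qed

text \<open>The density of \<open>ran G0\<close>, in the form in which it is used. It comes from the density of the joint range of the
  two boundary maps, by pairing with \<open>(y, 0)\<close> and \<open>(z, 0)\<close>.\<close>

lemma range_G0_separates:
  assumes "\<And>f x. (f, x) \<in> G0 \<Longrightarrow> cinner x y = cinner x z"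
  shows "y = z"
proof -
  let ?D = "{(G0 \<diamondop> f, G1 \<diamondop> f) |f. f \<in> Domain T}"
  have "closure ?D = UNIV" using qbt by (simp add: quasi_boundary_triple_def)
  moreover have "cinner p (y, 0) = cinner p (z, 0)" if p_in: "p \<in> ?D" for p
  proof -
    obtain f f' where p: "p = (G0 \<diamondop> f, G1 \<diamondop> f)" and f: "(f, f') \<in> T" using p_in by blast
    obtain x where x: "(f, x) \<in> G0" using boundary_values[OF f] .
    then show ?thesis
      using assms[OF x] by (simp add: p cinner_prod_def linear_operator_app_eq[OF linear_G0 x]
          cinner.zero_right)
  qed
  ultimately have "(y, 0 :: 'g) = (z, 0)" by (rule eq_on_closure_cinner)
  then show ?thesis by simp
qed

text \<open>The decomposition \<open>dom T = ker G0 + ker (T - c)\<close>: subtract from \<open>f\<close> the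
  preimage of \<open>(T - c) f\<close> under \<open>A\<^sub>0 - c\<close>. It is stated for the two boundary maps alike, since it is
  also used with \<open>G1\<close> at points of the resolvent set of \<open>A\<^sub>1\<close>.\<close>

lemma boundary_value_on_ker:
  assumes lin: "linear_operator G" and surj: "\<And>h. \<exists>f. (f, h + c *\<^sub>C f) \<in> T \<restriction> ker_op G"
    and f: "(f, f') \<in> T" "(f, x) \<in> G"
  obtains g where "(g, x) \<in> G" and "(g, c *\<^sub>C g) \<in> T"
proof -
  obtain f0 where "(f0, (f' - c *\<^sub>C f) + c *\<^sub>C f0) \<in> T \<restriction> ker_op G" using surj by blast
  then have f0: "(f0, (f' - c *\<^sub>C f) + c *\<^sub>C f0) \<in> T" "(f0, 0) \<in> G"
    by (simp_all add: restrict_ker_op_iff)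
  have "f' - ((f' - c *\<^sub>C f) + c *\<^sub>C f0) = c *\<^sub>C (f - f0)"
    by (simp add: complex_vector.scale_right_diff_distrib)
  then have "(f - f0, c *\<^sub>C (f - f0)) \<in> T"
    using linear_operator_diff[OF linear_T f(1) f0(1)] by simp
  moreover have "(f - f0, x) \<in> G"
    using linear_operator_diff[OF lin f(2) f0(2)] by simp
  ultimately show thesis by (rule that[rotated])
qed

lemma gamma_field_exists:
  assumes "c \<in> resolvent_set (T \<restriction> ker_op G0)" and x: "(f, x) \<in> G0"
  obtains g where "(g, x) \<in> G0" and "(g, c *\<^sub>C g) \<in> T"
proof -
  obtain f' where "(f, f') \<in> T" using G0_domain[OF x] .
  then show thesis
    by (rule boundary_value_on_ker[OF linear_G0 resolvent_set_imp_surj[OF assms(1)] _ x that])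
qed

lemma gamma_field_cnj_exists:
  assumes "c \<in> resolvent_set (T \<restriction> ker_op G0)" and x: "(f, x) \<in> G0"
  obtains g where "(g, x) \<in> G0" and "(g, cnj c *\<^sub>C g) \<in> T"
proof -
  obtain f' where "(f, f') \<in> T" using G0_domain[OF x] .
  then show thesis
    by (rule boundary_value_on_ker[OF linear_G0
          self_adjoint_surj_cnj[OF self_adjoint_A0 assms(1)] _ x that])
qed

text \<open>The identity \<open>\<gamma>(c\<^sup>*)\<^sup>* = G1 (A\<^sub>0 - c)\<^sup>-\<^sup>1\<close>. Green's identity shows that
  the right-hand side is contained in the left; there is equality because the right-hand side is everywhere
  defined and the adjoint of the densely defined \<open>\<gamma>(c\<^sup>*)\<close> is single-valued.\<close>

lemma adjoint_gamma_field_iff: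
  assumes c: "c \<in> resolvent_set (T \<restriction> ker_op G0)"
  shows "(h, z) \<in> op_adjoint (gamma_field T G0 (cnj c)) \<longleftrightarrow>
    (\<exists>f. (f, h + c *\<^sub>C f) \<in> T \<restriction> ker_op G0 \<and> (f, z) \<in> G1)"
proof -
  have incl: "cinner u h = cinner x z"
    if f: "(f, h + c *\<^sub>C f) \<in> T \<restriction> ker_op G0" "(f, z) \<in> G1"
      and u: "(x, u) \<in> gamma_field T G0 (cnj c)" for f z x u
  proof -
    have u': "(u, x) \<in> G0" "(u, cnj c *\<^sub>C u) \<in> T" using u by (simp_all add: gamma_field_iff)
    obtain w where w: "(u, w) \<in> G1" using boundary_values[OF u'(2)] .
    have "cinner (cnj c *\<^sub>C u) f - cinner u (h + c *\<^sub>C f) = cinner w 0 - cinner x z"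
      using f by (intro green[OF u'(2,1) w]) (simp_all add: restrict_ker_op_iff)
    then show ?thesis
      by (simp add: cinner_scaleC_left cinner_add_right cinner_scaleC_right cinner.zero_right)
  qed
  show ?thesis
  proof
    assume hz: "(h, z) \<in> op_adjoint (gamma_field T G0 (cnj c))"
    obtain f where f: "(f, h + c *\<^sub>C f) \<in> T \<restriction> ker_op G0" using resolvent_set_imp_surj[OF c] by blast
    then have "(f, h + c *\<^sub>C f) \<in> T" by (simp add: restrict_ker_op_iff)
    then obtain y where y: "(f, y) \<in> G1" by (rule boundary_values)
    have "y = z"
    proof (rule range_G0_separates)
      fix g x assume "(g, x) \<in> G0"
      then obtain u where "(u, x) \<in> G0" "(u, cnj c *\<^sub>C u) \<in> T"
        by (rule gamma_field_cnj_exists[OF c])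
      then have u: "(x, u) \<in> gamma_field T G0 (cnj c)" by (simp add: gamma_field_iff)
      show "cinner x y = cinner x z"
        using incl[OF f y u] op_adjointD[OF hz u] by simp
    qed
    then show "\<exists>f. (f, h + c *\<^sub>C f) \<in> T \<restriction> ker_op G0 \<and> (f, z) \<in> G1" using f y by blast
  next
    assume "\<exists>f. (f, h + c *\<^sub>C f) \<in> T \<restriction> ker_op G0 \<and> (f, z) \<in> G1"
    then show "(h, z) \<in> op_adjoint (gamma_field T G0 (cnj c))"
      unfolding op_adjoint_def using incl by blast
  qed
qed

text \<open>At real points \<open>M(c)\<close> is symmetric and densely defined, so that its closure lies in the operator
  \<open>M(c)\<^sup>*\<close> and agrees with \<open>M(c)\<close> on the domain of \<open>M(c)\<close>.\<close>

lemma closure_weyl_function_unique: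
  assumes c: "c \<in> resolvent_set (T \<restriction> ker_op G0)" "c \<in> \<real>"
    and y: "(x, y) \<in> weyl_function T G0 G1 c"
    and z: "(x, z) \<in> closure (weyl_function T G0 G1 c)"
  shows "z = y"
proof (rule range_G0_separates)
  let ?M = "weyl_function T G0 G1 c"
  have "?M \<subseteq> op_adjoint ?M"
    unfolding op_adjoint_def
  proof clarify
    fix a b u v assume "(a, b) \<in> ?M" "(u, v) \<in> ?M"
    then obtain f g where "(f, a) \<in> G0" "(f, c *\<^sub>C f) \<in> T" "(f, b) \<in> G1"
      and "(g, u) \<in> G0" "(g, c *\<^sub>C g) \<in> T" "(g, v) \<in> G1"
      by (auto simp: weyl_function_iff)
    from green[OF this(5,4,6,2,1,3)] show "cinner v a = cinner u b"
      using cnj_eq_of_mem_Reals[OF c(2)] by (simp add: cinner_scaleC_left cinner_scaleC_right)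
  qed
  then have sub: "closure ?M \<subseteq> op_adjoint ?M" by (intro closure_minimal closed_op_adjoint)
  fix f u assume "(f, u) \<in> G0"
  then obtain g where g: "(g, u) \<in> G0" "(g, c *\<^sub>C g) \<in> T"
    by (rule gamma_field_exists[OF c(1)])
  obtain v where "(g, v) \<in> G1" using boundary_values[OF g(2)] .
  then have uv: "(u, v) \<in> ?M" using g by (auto simp: weyl_function_iff)
  show "cinner u z = cinner u y"
    using op_adjointD[OF _ uv] sub z y closure_subset by (metis subsetD)
qed

text \<open>\<open>A\<^sub>0 \<subseteq> S\<^sup>*\<close> gives \<open>S \<subseteq> A\<^sub>0\<^sup>* = A\<^sub>0\<close>. For \<open>f \<in> dom S\<close> Green's identity then reads
  \<open>0 = (G1 f, G0 g)\<close> for all \<open>g\<close>, and \<open>G0\<close> has dense range.\<close>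

lemma minimal_operator_boundary_values:
  assumes S: "(f, f') \<in> S"
  shows "(f, f') \<in> T" and "(f, 0) \<in> G0" and "(f, 0) \<in> G1"
proof -
  have TS: "T \<subseteq> op_adjoint S" using qbt by (simp add: quasi_boundary_triple_def)
  have S_T: "cinner f' g = cinner f g'" if "(g, g') \<in> T" for g g'
    using op_adjointD[OF _ S] TS that by blast
  have "(f, f') \<in> op_adjoint (T \<restriction> ker_op G0)"
    unfolding op_adjoint_def
  proof clarify
    fix u v assume "(u, v) \<in> T \<restriction> ker_op G0"
    then have "cinner f' u = cinner f v" using S_T by (simp add: restrict_ker_op_iff)
    then show "cinner v f = cinner u f'" by (metis cinner_commute)
  qed
  then have "(f, f') \<in> T \<restriction> ker_op G0" using self_adjoint_A0 by (simp add: self_adjoint_op_def)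
  then show f: "(f, f') \<in> T" "(f, 0) \<in> G0" by (simp_all add: restrict_ker_op_iff)
  obtain y where y: "(f, y) \<in> G1" using boundary_values[OF f(1)] .
  have "y = 0"
  proof (rule range_G0_separates)
    fix g x assume x: "(g, x) \<in> G0"
    obtain g' where g: "(g, g') \<in> T" using G0_domain[OF x] .
    obtain w where w: "(g, w) \<in> G1" using boundary_values[OF g] .
    have "cinner y x = 0"
      using green[OF f y g x w] S_T[OF g] by (simp add: cinner.zero_left)
    then show "cinner x y = cinner x 0"
      by (metis cinner_commute complex_cnj_zero cinner.zero_right)
  qed
  then show "(f, 0) \<in> G1" using y by simp
qed

section \<open>The boundary condition \<open>\<Gamma>\<^sub>0 f = B \<Gamma>\<^sub>1 f\<close>\<close>

lemma A_bracket_iff: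
  assumes B: "linear_operator B" "Domain B = UNIV"
  shows "(f, f') \<in> A_bracket T G0 G1 B \<longleftrightarrow>
    (f, f') \<in> T \<and> (\<exists>x y. (f, x) \<in> G0 \<and> (f, y) \<in> G1 \<and> (y, x) \<in> B)"
proof
  assume "(f, f') \<in> A_bracket T G0 G1 B"
  then have f: "(f, f') \<in> T" and eq: "G0 \<diamondop> f = B \<diamondop> (G1 \<diamondop> f)"
    by (simp_all add: A_bracket_def restrict_op_def)
  obtain x y where x: "(f, x) \<in> G0" and y: "(f, y) \<in> G1" using boundary_values[OF f] .
  obtain z where z: "(y, z) \<in> B" using B(2) by blast
  have "x = z"
    using eq linear_operator_app_eq[OF linear_G0 x] linear_operator_app_eq[OF linear_G1 y]
      linear_operator_app_eq[OF B(1) z] by simp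
  then show "(f, f') \<in> T \<and> (\<exists>x y. (f, x) \<in> G0 \<and> (f, y) \<in> G1 \<and> (y, x) \<in> B)"
    using f x y z by blast
next
  assume "(f, f') \<in> T \<and> (\<exists>x y. (f, x) \<in> G0 \<and> (f, y) \<in> G1 \<and> (y, x) \<in> B)"
  then obtain x y where *: "(f, f') \<in> T" "(f, x) \<in> G0" "(f, y) \<in> G1" "(y, x) \<in> B" by blast
  then have "G0 \<diamondop> f = B \<diamondop> (G1 \<diamondop> f)"
    using linear_operator_app_eq[OF linear_G0 *(2)] linear_operator_app_eq[OF linear_G1 *(3)]
      linear_operator_app_eq[OF B(1) *(4)] by simp
  then show "(f, f') \<in> A_bracket T G0 G1 B"
    using *(1) by (auto simp: A_bracket_def restrict_op_def)
qed

lemma linear_A_bracket: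
  assumes B: "linear_operator B" "Domain B = UNIV"
  shows "linear_operator (A_bracket T G0 G1 B)"
proof (rule linear_operatorI; unfold A_bracket_iff[OF B])
  show "(0, 0) \<in> T \<and> (\<exists>x y. (0, x) \<in> G0 \<and> (0, y) \<in> G1 \<and> (y, x) \<in> B)"
    using linear_operator_zero[OF linear_T] linear_operator_zero[OF linear_G0]
      linear_operator_zero[OF linear_G1] linear_operator_zero[OF B(1)] by blast
qed (blast intro: linear_operator_add[OF linear_T] linear_operator_add[OF linear_G0]
    linear_operator_add[OF linear_G1] linear_operator_add[OF B(1)]
    linear_operator_scaleC[OF linear_T] linear_operator_scaleC[OF linear_G0]
    linear_operator_scaleC[OF linear_G1] linear_operator_scaleC[OF B(1)]
    dest: linear_operator_unique[OF linear_T])+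

lemma symmetric_A_bracket:
  assumes B: "linear_operator B" "Domain B = UNIV" "symmetric_op B"
  shows "symmetric_op (A_bracket T G0 G1 B)"
  unfolding symmetric_op_def
proof clarify
  fix f f' g g' assume "(f, f') \<in> A_bracket T G0 G1 B" "(g, g') \<in> A_bracket T G0 G1 B"
  then obtain x0 x1 y0 y1 where f: "(f, f') \<in> T" "(f, x0) \<in> G0" "(f, x1) \<in> G1" "(x1, x0) \<in> B"
    and g: "(g, g') \<in> T" "(g, y0) \<in> G0" "(g, y1) \<in> G1" "(y1, y0) \<in> B"
    unfolding A_bracket_iff[OF B(1,2)] by blast
  show "cinner f' g = cinner f g'"
    using green[OF f(1-3) g(1-3)] symmetric_opD[OF B(3) f(4) g(4)] by simp
qed

lemma minimal_operator_subset_A_bracket: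
  assumes B: "linear_operator B" "Domain B = UNIV"
  shows "S \<subseteq> A_bracket T G0 G1 B"
proof clarify
  fix f f' assume "(f, f') \<in> S"
  then show "(f, f') \<in> A_bracket T G0 G1 B"
    unfolding A_bracket_iff[OF B]
    using minimal_operator_boundary_values linear_operator_zero[OF B(1)] by blast
qed

text \<open>If \<open>c \<in> \<rho>(A\<^sub>1)\<close>, then \<open>dom T = ker G1 + ker (T - c)\<close>, so that \<open>ran G1 = ran M(c)\<close>.\<close>

lemma range_G1_subset_range_weyl_function:
  assumes c: "c \<in> resolvent_set (T \<restriction> ker_op G1)"
  shows "Range G1 \<subseteq> Range (weyl_function T G0 G1 c)"
proof clarify
  fix f y assume y: "(f, y) \<in> G1"
  obtain f' where f: "(f, f') \<in> T" using G1_domain[OF y] .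
  obtain g where g: "(g, y) \<in> G1" "(g, c *\<^sub>C g) \<in> T"
    by (rule boundary_value_on_ker[OF linear_G1 resolvent_set_imp_surj[OF c] f y])
  obtain x where "(g, x) \<in> G0" using boundary_values[OF g(2)] .
  then have "(x, y) \<in> weyl_function T G0 G1 c" using g by (auto simp: weyl_function_iff)
  then show "y \<in> Range (weyl_function T G0 G1 c)" by blast
qed

text \<open>To solve \<open>(A\<^sub>B - c) f = h\<close> write \<open>f = f\<^sub>0 + g\<close> with \<open>(A\<^sub>0 - c) f\<^sub>0 = h\<close> and \<open>g = \<gamma>(c) x\<close>; the
  boundary condition becomes \<open>x = B G1 f\<^sub>0 + B M(c) x\<close>. The hypothesis \<open>1 \<in> \<rho>(B M)\<close> for the closure
  provides a solution \<open>x\<close> of the equation with the closure of \<open>M(c)\<close> in place of \<open>M(c)\<close>; since both summands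
  on the right lie in the range of \<open>G0\<close>, so does \<open>x\<close>, and the closure acts on it as \<open>M(c)\<close>.\<close>

lemma A_bracket_surj:
  assumes c: "c \<in> resolvent_set (T \<restriction> ker_op G0)" "c \<in> \<real>"
    and B: "linear_operator B" "Domain B = UNIV"
    and one: "1 \<in> resolvent_set (B \<cdot>\<^sub>o closure (weyl_function T G0 G1 c))"
    and ranM: "B `` Range (closure (weyl_function T G0 G1 c)) \<subseteq> Range G0"
    and ranG1: "B `` Range G1 \<subseteq> Range G0"
  shows "\<exists>f. (f, h + c *\<^sub>C f) \<in> A_bracket T G0 G1 B"
proof -
  let ?M = "weyl_function T G0 G1 c"
  obtain f0 where f0: "(f0, h + c *\<^sub>C f0) \<in> T" "(f0, 0) \<in> G0"
    using resolvent_set_imp_surj[OF c(1)] unfolding restrict_ker_op_iff by blast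
  obtain y0 where y0: "(f0, y0) \<in> G1" using boundary_values[OF f0(1)] .
  obtain b where b: "(y0, b) \<in> B" using B(2) by blast
  obtain x where "(x, - b + 1 *\<^sub>C x) \<in> B \<cdot>\<^sub>o closure ?M" using resolvent_set_imp_surj[OF one] by blast
  then obtain z where z: "(x, z) \<in> closure ?M" and zx: "(z, x - b) \<in> B"
    by (auto simp: op_times_def scaleC_one)
  have "b \<in> Range G0" "x - b \<in> Range G0" using ranG1 ranM y0 b z zx by blast+
  then obtain f1 f2 where "(f1, b) \<in> G0" "(f2, x - b) \<in> G0" by blast
  then have "(f1 + f2, x) \<in> G0" using linear_operator_add[OF linear_G0] by fastforce
  then obtain g where g: "(g, x) \<in> G0" "(g, c *\<^sub>C g) \<in> T"
    by (rule gamma_field_exists[OF c(1)])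
  obtain y where y: "(g, y) \<in> G1" using boundary_values[OF g(2)] .
  then have "(x, y) \<in> ?M" using g by (auto simp: weyl_function_iff)
  then have "z = y" using closure_weyl_function_unique[OF c] z by blast
  then have "(y0 + y, b + (x - b)) \<in> B" using linear_operator_add[OF B(1) b zx] by simp
  moreover have "(f0 + g, h + c *\<^sub>C (f0 + g)) \<in> T"
    using linear_operator_add[OF linear_T f0(1) g(2)]
    by (simp add: scaleC_add_right algebra_simps)
  moreover have "(f0 + g, x) \<in> G0" "(f0 + g, y0 + y) \<in> G1"
    using linear_operator_add[OF linear_G0 f0(2) g(1)] linear_operator_add[OF linear_G1 y0 y]
    by simp_all
  ultimately have "(f0 + g, h + c *\<^sub>C (f0 + g)) \<in> A_bracket T G0 G1 B"
    by (auto simp: A_bracket_iff[OF B])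
  then show ?thesis by blast
qed

text \<open>A solution of \<open>x = B M(c) x\<close> yields the eigenvector \<open>\<gamma>(c) x\<close> of \<open>A\<^sub>B\<close> at \<open>c\<close>.\<close>

lemma single_valued_inverse_Id_minus_weyl:
  assumes B: "linear_operator B" "Domain B = UNIV"
    and c: "c \<in> resolvent_set (A_bracket T G0 G1 B)"
  shows "single_valued ((Id -\<^sub>o B \<cdot>\<^sub>o weyl_function T G0 G1 c)\<inverse>)"
proof (rule single_valuedI)
  fix y x x'
  assume "(y, x) \<in> (Id -\<^sub>o B \<cdot>\<^sub>o weyl_function T G0 G1 c)\<inverse>"
    and "(y, x') \<in> (Id -\<^sub>o B \<cdot>\<^sub>o weyl_function T G0 G1 c)\<inverse>"
  then obtain f v w f' v' w'
    where f: "(f, x) \<in> G0" "(f, c *\<^sub>C f) \<in> T" "(f, v) \<in> G1" "(v, w) \<in> B" "y = x - w"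
      and f': "(f', x') \<in> G0" "(f', c *\<^sub>C f') \<in> T" "(f', v') \<in> G1" "(v', w') \<in> B" "y = x' - w'"
    by (auto simp: op_minus_def op_times_def weyl_function_iff)
  have x: "x - x' = w - w'" using f(5) f'(5) by (simp add: algebra_simps)
  have "(f - f', c *\<^sub>C (f - f')) \<in> T"
    using linear_operator_diff[OF linear_T f(2) f'(2)]
    by (simp add: complex_vector.scale_right_diff_distrib)
  moreover have "(f - f', x - x') \<in> G0" "(f - f', v - v') \<in> G1" "(v - v', x - x') \<in> B"
    using linear_operator_diff[OF linear_G0 f(1) f'(1)] linear_operator_diff[OF linear_G1 f(3) f'(3)]
      linear_operator_diff[OF B(1) f(4) f'(4)] x by simp_all
  ultimately have "(f - f', c *\<^sub>C (f - f')) \<in> A_bracket T G0 G1 B"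
    by (auto simp: A_bracket_iff[OF B])
  then have "f - f' = 0"
    by (rule resolvent_set_imp_ker_trivial[OF linear_A_bracket[OF B] c])
  then have "f = f'" by simp
  then show "x = x'" using f(1) f'(1) linear_operator_unique[OF linear_G0] by blast
qed

text \<open>Membership in the graph on the right means exactly that \<open>f = f\<^sub>0 + g\<close> with \<open>f\<^sub>0 = (A\<^sub>0 - c)\<^sup>-\<^sup>1 h\<close> and
  \<open>g = \<gamma>(c) x\<close>, where \<open>x - B M(c) x = B G1 f\<^sub>0\<close>; the last equation is the boundary condition for \<open>f\<close>.\<close>

lemma krein_resolvent_formula:
  assumes B: "linear_operator B" "Domain B = UNIV"
    and c: "c \<in> resolvent_set (T \<restriction> ker_op G0)"
  shows "(A_bracket T G0 G1 B -\<^sub>o scalar_op c)\<inverse> =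
    ((T \<restriction> ker_op G0) -\<^sub>o scalar_op c)\<inverse> +\<^sub>o
    gamma_field T G0 c \<cdot>\<^sub>o (Id -\<^sub>o B \<cdot>\<^sub>o weyl_function T G0 G1 c)\<inverse> \<cdot>\<^sub>o B \<cdot>\<^sub>o
      op_adjoint (gamma_field T G0 (cnj c))"
    (is "?L = ?R")
proof -
  have R_iff: "(h, f) \<in> ?R \<longleftrightarrow> (\<exists>f0 g x y0 b f1 v w.
      f = f0 + g \<and> (f0, h + c *\<^sub>C f0) \<in> T \<restriction> ker_op G0 \<and>
      (f1, h + c *\<^sub>C f1) \<in> T \<restriction> ker_op G0 \<and> (f1, y0) \<in> G1 \<and> (y0, b) \<in> B \<and>
      (x, v) \<in> weyl_function T G0 G1 c \<and> (v, w) \<in> B \<and> b = x - w \<and>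
      (g, x) \<in> G0 \<and> (g, c *\<^sub>C g) \<in> T)" for h f
    unfolding op_plus_iff op_times_iff converse_iff Id_minus_iff minus_scalar_op_iff
      adjoint_gamma_field_iff[OF c] gamma_field_iff by blast
  show ?thesis
  proof (intro set_eqI iffI; clarify)
    fix h f assume "(f, h) \<in> A_bracket T G0 G1 B -\<^sub>o scalar_op c"
    then obtain x y where f: "(f, h + c *\<^sub>C f) \<in> T" "(f, x) \<in> G0" "(f, y) \<in> G1" "(y, x) \<in> B"
      by (auto simp: minus_scalar_op_iff A_bracket_iff[OF B])
    obtain f0 where f0: "(f0, h + c *\<^sub>C f0) \<in> T \<restriction> ker_op G0" using resolvent_set_imp_surj[OF c] by blast
    then have f0': "(f0, h + c *\<^sub>C f0) \<in> T" "(f0, 0) \<in> G0" by (simp_all add: restrict_ker_op_iff)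
    obtain y0 where y0: "(f0, y0) \<in> G1" using boundary_values[OF f0'(1)] .
    obtain b where b: "(y0, b) \<in> B" using B(2) by blast
    have g: "(f - f0, c *\<^sub>C (f - f0)) \<in> T" "(f - f0, x) \<in> G0" "(f - f0, y - y0) \<in> G1"
      using linear_operator_diff[OF linear_T f(1) f0'(1)]
        linear_operator_diff[OF linear_G0 f(2) f0'(2)] linear_operator_diff[OF linear_G1 f(3) y0]
      by (simp_all add: complex_vector.scale_right_diff_distrib)
    then have "(x, y - y0) \<in> weyl_function T G0 G1 c" by (auto simp: weyl_function_iff)
    moreover have "(y - y0, x - b) \<in> B" by (rule linear_operator_diff[OF B(1) f(4) b])
    moreover have "f = f0 + (f - f0)" "b = x - (x - b)" by simp_all
    ultimately show "(h, f) \<in> ?R" unfolding R_iff using f0 y0 b g by blast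
  next
    fix h f assume "(h, f) \<in> ?R"
    then obtain f0 g x y0 b f1 v w where f: "f = f0 + g"
      and f0: "(f0, h + c *\<^sub>C f0) \<in> T \<restriction> ker_op G0" and f1: "(f1, h + c *\<^sub>C f1) \<in> T \<restriction> ker_op G0"
      and y0: "(f1, y0) \<in> G1" and b: "(y0, b) \<in> B"
      and v: "(x, v) \<in> weyl_function T G0 G1 c" and w: "(v, w) \<in> B" "b = x - w"
      and g: "(g, x) \<in> G0" "(g, c *\<^sub>C g) \<in> T"
      unfolding R_iff by blast
    \<comment> \<open>The resolvent of \<open>A\<^sub>0\<close> and \<open>\<gamma>(c)\<close> are single-valued, so the preimages hidden in \<open>\<gamma>(c\<^sup>*)\<^sup>*\<close> and
      in \<open>M(c)\<close> are \<open>f\<^sub>0\<close> and \<open>g\<close>.\<close>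
    have "f1 = f0" by (rule resolvent_set_imp_inj[OF c f1 f0])
    obtain k where k: "(k, x) \<in> G0" "(k, c *\<^sub>C k) \<in> T" "(k, v) \<in> G1"
      using v by (auto simp: weyl_function_iff)
    have "(g - k, c *\<^sub>C (g - k)) \<in> T \<restriction> ker_op G0"
      using linear_operator_diff[OF linear_T g(2) k(2)] linear_operator_diff[OF linear_G0 g(1) k(1)]
      by (simp add: restrict_ker_op_iff complex_vector.scale_right_diff_distrib)
    then have "g - k = 0" by (rule resolvent_set_imp_ker_trivial[OF linear_A0 c])
    then have "g = k" by simp
    have f0': "(f0, h + c *\<^sub>C f0) \<in> T" "(f0, 0) \<in> G0"
      using f0 by (simp_all add: restrict_ker_op_iff)
    have "(f, h + c *\<^sub>C f) \<in> T"
      using linear_operator_add[OF linear_T f0'(1) g(2)]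
      by (simp add: f scaleC_add_right algebra_simps)
    moreover have "(f, x) \<in> G0" using linear_operator_add[OF linear_G0 f0'(2) g(1)] by (simp add: f)
    moreover have "(f, y0 + v) \<in> G1"
      using linear_operator_add[OF linear_G1 y0 k(3)] by (simp add: f \<open>f1 = f0\<close> \<open>g = k\<close>)
    moreover have "(y0 + v, x) \<in> B" using linear_operator_add[OF B(1) b w(1)] by (simp add: w(2))
    ultimately have "(f, h + c *\<^sub>C f) \<in> A_bracket T G0 G1 B" by (auto simp: A_bracket_iff[OF B])
    then show "(f, h) \<in> A_bracket T G0 G1 B -\<^sub>o scalar_op c" by (simp add: minus_scalar_op_iff)
  qed
qed

end

theorem corollary2p7:
  fixes S T A\<^sub>0 A\<^sub>1 A\<^sub>B :: "('h::complex_hilbert \<times> 'h) set"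
    and \<Gamma>\<^sub>0 \<Gamma>\<^sub>1 :: "('h \<times> 'g::complex_hilbert) set"
    and B :: "('g \<times> 'g) set"
    and \<gamma> :: "complex \<Rightarrow> ('g \<times> 'h) set"
    and M :: "complex \<Rightarrow> ('g \<times> 'g) set"
    and \<mu>\<^sub>0 :: complex
  defines "A\<^sub>0 \<equiv> T \<restriction> ker_op \<Gamma>\<^sub>0"
    and "A\<^sub>1 \<equiv> T \<restriction> ker_op \<Gamma>\<^sub>1"
    and "\<gamma> \<equiv> gamma_field T \<Gamma>\<^sub>0"
    and "M \<equiv> weyl_function T \<Gamma>\<^sub>0 \<Gamma>\<^sub>1"
    and "A\<^sub>B \<equiv> A_bracket T \<Gamma>\<^sub>0 \<Gamma>\<^sub>1 B"
  assumes "linear_operator S" and "densely_defined S" and "closed S" and "symmetric_op S"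
    and "quasi_boundary_triple S T \<Gamma>\<^sub>0 \<Gamma>\<^sub>1"
    and "bounded_everywhere_op B" and "self_adjoint_op B"
    and "\<mu>\<^sub>0 \<in> resolvent_set A\<^sub>0 \<inter> \<real>"
    and "1 \<in> resolvent_set (B \<cdot>\<^sub>o closure (M \<mu>\<^sub>0))"
    and "B `` Range (closure (M \<mu>\<^sub>0)) \<subseteq> Range \<Gamma>\<^sub>0"
    and "B `` Range \<Gamma>\<^sub>1 \<subseteq> Range \<Gamma>\<^sub>0 \<or> \<mu>\<^sub>0 \<in> resolvent_set A\<^sub>1"
  shows "self_adjoint_op A\<^sub>B \<and> S \<subseteq> A\<^sub>B \<and> \<mu>\<^sub>0 \<in> resolvent_set A\<^sub>B \<and>
    (\<forall>\<mu> \<in> resolvent_set A\<^sub>B \<inter> resolvent_set A\<^sub>0.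
       single_valued ((Id -\<^sub>o B \<cdot>\<^sub>o M \<mu>)\<inverse>) \<and>
       (A\<^sub>B -\<^sub>o scalar_op \<mu>)\<inverse> =
         (A\<^sub>0 -\<^sub>o scalar_op \<mu>)\<inverse> +\<^sub>o
         \<gamma> \<mu> \<cdot>\<^sub>o (Id -\<^sub>o B \<cdot>\<^sub>o M \<mu>)\<inverse> \<cdot>\<^sub>o B \<cdot>\<^sub>o op_adjoint (\<gamma> (cnj \<mu>)))"
proof -
  interpret quasi_bt S T \<Gamma>\<^sub>0 \<Gamma>\<^sub>1 using \<open>quasi_boundary_triple S T \<Gamma>\<^sub>0 \<Gamma>\<^sub>1\<close> by unfold_locales
  have B: "linear_operator B" "Domain B = UNIV"
    using \<open>bounded_everywhere_op B\<close> by (simp_all add: bounded_everywhere_op_def)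
  have "symmetric_op B"
    using \<open>self_adjoint_op B\<close> by (auto simp: self_adjoint_op_def symmetric_op_def dest: op_adjointD)
  then have sym: "symmetric_op A\<^sub>B" unfolding A\<^sub>B_def by (rule symmetric_A_bracket[OF B])
  have lin: "linear_operator A\<^sub>B" unfolding A\<^sub>B_def by (rule linear_A_bracket[OF B])
  have ext: "S \<subseteq> A\<^sub>B" unfolding A\<^sub>B_def by (rule minimal_operator_subset_A_bracket[OF B])
  have dense: "densely_defined A\<^sub>B"
    using \<open>densely_defined S\<close> closure_mono[OF Domain_mono[OF ext]]
    by (auto simp: densely_defined_def)
  have real: "\<mu>\<^sub>0 \<in> \<real>" and res: "\<mu>\<^sub>0 \<in> resolvent_set (T \<restriction> ker_op \<Gamma>\<^sub>0)"
    using \<open>\<mu>\<^sub>0 \<in> resolvent_set A\<^sub>0 \<inter> \<real>\<close> by (simp_all add: A\<^sub>0_def)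
  have ranM: "B `` Range (closure (weyl_function T \<Gamma>\<^sub>0 \<Gamma>\<^sub>1 \<mu>\<^sub>0)) \<subseteq> Range \<Gamma>\<^sub>0"
    using \<open>B `` Range (closure (M \<mu>\<^sub>0)) \<subseteq> Range \<Gamma>\<^sub>0\<close> by (simp add: M_def)
  have ranG1: "B `` Range \<Gamma>\<^sub>1 \<subseteq> Range \<Gamma>\<^sub>0"
    using \<open>B `` Range \<Gamma>\<^sub>1 \<subseteq> Range \<Gamma>\<^sub>0 \<or> \<mu>\<^sub>0 \<in> resolvent_set A\<^sub>1\<close>
  proof
    assume "\<mu>\<^sub>0 \<in> resolvent_set A\<^sub>1"
    then have "Range \<Gamma>\<^sub>1 \<subseteq> Range (weyl_function T \<Gamma>\<^sub>0 \<Gamma>\<^sub>1 \<mu>\<^sub>0)"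
      unfolding A\<^sub>1_def by (rule range_G1_subset_range_weyl_function)
    also have "\<dots> \<subseteq> Range (closure (weyl_function T \<Gamma>\<^sub>0 \<Gamma>\<^sub>1 \<mu>\<^sub>0))"
      by (intro Range_mono closure_subset)
    finally show ?thesis using ranM by blast
  qed
  have surj: "\<exists>f. (f, h + \<mu>\<^sub>0 *\<^sub>C f) \<in> A\<^sub>B" for h
    using \<open>1 \<in> resolvent_set (B \<cdot>\<^sub>o closure (M \<mu>\<^sub>0))\<close>
    unfolding A\<^sub>B_def M_def by (rule A_bracket_surj[OF res real B _ ranM ranG1])
  have "self_adjoint_op A\<^sub>B" by (rule self_adjoint_opI[OF lin dense sym real surj])
  moreover have "\<mu>\<^sub>0 \<in> resolvent_set A\<^sub>B"
    by (rule symmetric_surj_imp_resolvent_set[OF lin sym real surj])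
  moreover have "single_valued ((Id -\<^sub>o B \<cdot>\<^sub>o M \<mu>)\<inverse>)" if "\<mu> \<in> resolvent_set A\<^sub>B" for \<mu>
    using single_valued_inverse_Id_minus_weyl[OF B] that by (simp add: A\<^sub>B_def M_def)
  moreover have "(A\<^sub>B -\<^sub>o scalar_op \<mu>)\<inverse> =
      (A\<^sub>0 -\<^sub>o scalar_op \<mu>)\<inverse> +\<^sub>o
      \<gamma> \<mu> \<cdot>\<^sub>o (Id -\<^sub>o B \<cdot>\<^sub>o M \<mu>)\<inverse> \<cdot>\<^sub>o B \<cdot>\<^sub>o op_adjoint (\<gamma> (cnj \<mu>))"
    if "\<mu> \<in> resolvent_set A\<^sub>0" for \<mu>
    using krein_resolvent_formula[OF B] that
    unfolding A\<^sub>B_def A\<^sub>0_def M_def \<gamma>_def by blast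
  ultimately show ?thesis using ext by blast
qed

end
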